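(* Let $(\mathcal{X},d_{\mathcal{X}})$ be a compact metric space equipped with its Borel $\sigma$-field and a nondegenerate probability measure $\mathbb{P}$, let $(\mathcal{Y},d_{\mathcal{Y}})$ be a metric space, and let the data sites in $X_N=\{x_1,\ldots,x_N\}$ be drawn independently according to $\mathbb{P}$. Let $f\colon\mathcal{X}\to\mathcal{Y}$ be a function, let $f_N=f|_{X_N}$, and let $\rho\colon[0,\infty]\to[0,\infty]$ be monotonically increasing. Let $\rho(\cdot)^{-1}\omega(f,\cdot)\colon[0,\infty]\to[0,\infty)$ be continuous and $|f|_\rho<\infty$. Then $$\lim_{N\to\infty}|f_N|_{\rho,N}=\lim_{N\to\infty}|f|_{\rho,N}=|f|_\rho$$ $\mathbb{P}$-almost surely.
   Context: Nondegenerate means that all open neighborhoods of all elements of $\mathcal{X}$ have positive measure. The modulus of continuity is $\omega(f,t)=\sup\{d_{\mathcal{Y}}(f(x),f(x')): x,x'\in\mathcal{X},\ d_{\mathcal{X}}(x,x')\leq t\}$, $t\in[0,\infty]$, and $|f|_\rho=\sup_{t>0}\rho(t)^{-1}\omega(f,t)$. With $d_{i,j}=d_{\mathcal{X}}(x_i,x_j)$, the discrete modulus of continuity is $\omega_N(f,t)=\max\{d_{\mathcal{Y}}(f(x_i),f(x_j)): x_i,x_j\in X_N,\ d_{i,j}\leq t\}$, and the discrete seminorm is $|f|_{\rho,N}=\max_{i,j\in\{1,\ldots,N\},\,i\neq j}\rho(d_{i,j})^{-1}\omega_N(f,d_{i,j})$. For the restriction $f_N=f|_{X_N}$, $|f_N|_{\rho,N}$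 is defined by the same formula (it depends only on the values $f(x_i)$). *)

theory Defs
  imports "HOL-Probability.Probability"
begin

definition nondegenerate :: "'a::topological_space measure \<Rightarrow> bool" where
  "nondegenerate M \<longleftrightarrow> (\<forall>x U. open U \<longrightarrow> x \<in> U \<longrightarrow> emeasure M U > 0)"

text \<open>The extended half-line $[0,\infty]$ is the type \<^typ>\<open>ennreal\<close>, where
  \<open>inverse 0 = \<infinity>\<close>, \<open>inverse \<infinity> = 0\<close> and \<open>0 * \<infinity> = 0\<close>.\<close>

definition modulus :: "('a::metric_space \<Rightarrow> 'b::metric_space) \<Rightarrow> ennreal \<Rightarrow> ennreal" where
  "modulus f t = Sup {ennreal (dist (f x) (f x')) | x x'. ennreal (dist x x') \<le> t}"

definition weighted_modulus ::
  "(ennreal \<Rightarrow> ennreal) \<Rightarrow> ('a::metric_space \<Rightarrow> 'b::metric_space) \<Rightarrow> ennreal \<Rightarrow> ennreal" where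
  "weighted_modulus \<rho> f t = inverse (\<rho> t) * modulus f t"

definition rho_seminorm ::
  "(ennreal \<Rightarrow> ennreal) \<Rightarrow> ('a::metric_space \<Rightarrow> 'b::metric_space) \<Rightarrow> ennreal" where
  "rho_seminorm \<rho> f = (SUP t\<in>{0<..}. weighted_modulus \<rho> f t)"

text \<open>Continuity and finiteness of $\rho(\cdot)^{-1}\omega(f,\cdot)$ on all of $[0,\infty]$. Since
  \<open>modulus f 0 = 0\<close>, the value at \<open>0\<close> is an indeterminate $0/0$ when \<open>\<rho> 0 = 0\<close>. Two readings
  of that value are admitted: the literal one (\<open>\<infinity> * 0 = 0\<close>), and, if \<open>\<rho>\<close> is
  continuous at its zero \<open>0\<close>, the value \<open>c\<close> of the continuous extension, so that
  e.g. \<open>\<rho> t = t\<close> and a Lipschitz \<open>f\<close> are not excluded. Continuity of \<open>\<rho>\<close> at \<open>0\<close>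
  cannot be dropped in the second case: with \<open>\<rho> 0 = 0\<close> and \<open>\<rho> t = 1\<close> for \<open>t > 0\<close>, the indicator
  of a point in $[0,1]$ has $\rho(t)^{-1}\omega(f,t) = 1$ for all \<open>t > 0\<close>, but a uniform sample almost
  surely misses that point.\<close>

definition continuous_weighted_modulus ::
  "(ennreal \<Rightarrow> ennreal) \<Rightarrow> ('a::metric_space \<Rightarrow> 'b::metric_space) \<Rightarrow> bool" where
  "continuous_weighted_modulus \<rho> f \<longleftrightarrow>
     (\<exists>c. (c = weighted_modulus \<rho> f 0 \<or> \<rho> 0 = 0 \<and> isCont \<rho> 0) \<and>
          continuous_on UNIV ((weighted_modulus \<rho> f)(0 := c)) \<and>
          (\<forall>t. ((weighted_modulus \<rho> f)(0 := c)) t < \<infinity>))"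

lemma continuous_weighted_modulusI:
  assumes "continuous_on UNIV (weighted_modulus \<rho> f)" "\<And>t. weighted_modulus \<rho> f t < \<infinity>"
  shows "continuous_weighted_modulus \<rho> f"
  unfolding continuous_weighted_modulus_def
  using assms by (intro exI[of _ "weighted_modulus \<rho> f 0"]) simp

text \<open>Data sites are given as a sequence \<open>x\<close>, of which \<open>x 1, \<dots>, x N\<close> are used. The maxima below
  range over nonempty sets for \<open>N \<ge> 1\<close> and \<open>N \<ge> 2\<close>, respectively; smaller \<open>N\<close> are irrelevant to
  limits.\<close>

definition discrete_modulus ::
  "('a::metric_space \<Rightarrow> 'b::metric_space) \<Rightarrow> (nat \<Rightarrow> 'a) \<Rightarrow> nat \<Rightarrow> ennreal \<Rightarrow> ennreal" where
  "discrete_modulus f x N t =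
     Max {ennreal (dist (f (x i)) (f (x j))) | i j.
            i \<in> {1..N} \<and> j \<in> {1..N} \<and> ennreal (dist (x i) (x j)) \<le> t}"

definition discrete_seminorm ::
  "(ennreal \<Rightarrow> ennreal) \<Rightarrow> ('a::metric_space \<Rightarrow> 'b::metric_space) \<Rightarrow> (nat \<Rightarrow> 'a) \<Rightarrow> nat \<Rightarrow> ennreal" where
  "discrete_seminorm \<rho> f x N =
     Max {inverse (\<rho> (ennreal (dist (x i) (x j)))) * discrete_modulus f x N (ennreal (dist (x i) (x j))) | i j.
            i \<in> {1..N} \<and> j \<in> {1..N} \<and> i \<noteq> j}"

end

theory Submission
  imports Defs
begin

text \<open>Almost surely the sample is dense. Unless the seminorm vanishes, continuity of
  $\rho^{-1}\omega(f,\cdot)$ forces \<open>f\<close> to be continuous. If $\rho(t)^{-1}\omega(f,t) > a$, then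
  by compactness $\omega(f,t)$ is attained at a pair at some distance \<open>s \<le> t\<close>, and
  $\rho(s)^{-1}\omega(f,s) > a$ by monotonicity of \<open>\<rho>\<close>. Although \<open>\<rho>\<close> may jump at \<open>s\<close>,
  $\rho^{-1}\omega(f,\cdot)$ does not, and $\omega(f,\cdot)$ is right continuous by compactness, so all
  pairs close to this one still have a difference quotient above \<open>a\<close>; the dense sample contains
  such a pair.\<close>

section \<open>Elementary bounds for the modulus and its discrete counterparts\<close>

lemma dist_le_modulus:
  "ennreal (dist y y') \<le> t \<Longrightarrow> ennreal (dist (f y) (f y')) \<le> modulus f t"
  unfolding modulus_def by (auto intro!: Sup_upper)

lemma modulus_le_iff:
  "modulus f t \<le> b \<longleftrightarrow>
     (\<forall>y y'. ennreal (dist y y') \<le> t \<longrightarrow> ennreal (dist (f y) (f y')) \<le> b)"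
  unfolding modulus_def by (auto simp: Sup_le_iff)

lemma modulus_0 [simp]: "modulus f 0 = 0"
  using modulus_le_iff[of f 0 0] by simp

lemma modulus_mono: "s \<le> t \<Longrightarrow> modulus f s \<le> modulus f t"
  by (subst modulus_le_iff) (blast intro: dist_le_modulus order_trans)

lemma finite_pairs: "finite {h i j | i j. i \<in> {1..N::nat} \<and> j \<in> {1..N} \<and> Q i j}"
  by (rule finite_subset[of _ "(\<lambda>(i,j). h i j) ` ({1..N} \<times> {1..N})"]) auto

lemma discrete_modulus_le_modulus:
  assumes "N \<ge> 1"
  shows "discrete_modulus f x N t \<le> modulus f t"
  unfolding discrete_modulus_def
proof (rule Max.boundedI[OF finite_pairs])
  show "{ennreal (dist (f (x i)) (f (x j))) | i j.
      i \<in> {1..N} \<and> j \<in> {1..N} \<and> ennreal (dist (x i) (x j)) \<le> t} \<noteq> {}"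
    using assms by (auto intro!: exI[of _ 1])
qed (auto intro: dist_le_modulus)

lemma dist_le_discrete_modulus:
  assumes "i \<in> {1..N}" "j \<in> {1..N}"
  shows "ennreal (dist (f (x i)) (f (x j))) \<le>
    discrete_modulus f x N (ennreal (dist (x i) (x j)))"
  unfolding discrete_modulus_def by (rule Max_ge[OF finite_pairs]) (use assms in blast)

lemma discrete_seminorm_le_rho_seminorm:
  assumes "N \<ge> 2"
  shows "discrete_seminorm \<rho> f x N \<le> rho_seminorm \<rho> f"
  unfolding discrete_seminorm_def
proof (rule Max.boundedI[OF finite_pairs])
  have "(1::nat) \<in> {1..N} \<and> 2 \<in> {1..N} \<and> (1::nat) \<noteq> 2"
    using assms by simp
  then show "{inverse (\<rho> (ennreal (dist (x i) (x j)))) *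
      discrete_modulus f x N (ennreal (dist (x i) (x j))) | i j.
      i \<in> {1..N} \<and> j \<in> {1..N} \<and> i \<noteq> j} \<noteq> {}"
    by blast
next
  fix v
  assume "v \<in> {inverse (\<rho> (ennreal (dist (x i) (x j)))) *
      discrete_modulus f x N (ennreal (dist (x i) (x j))) | i j.
      i \<in> {1..N} \<and> j \<in> {1..N} \<and> i \<noteq> j}"
  then obtain t where v: "v = inverse (\<rho> t) * discrete_modulus f x N t"
    by blast
  have v_le: "v \<le> weighted_modulus \<rho> f t"
    unfolding v weighted_modulus_def
    using assms by (intro mult_left_mono discrete_modulus_le_modulus) auto
  show "v \<le> rho_seminorm \<rho> f"
  \<comment> \<open>Sites with different indices may coincide. Then \<open>t = 0\<close>, a point
    left out of the supremum in \<open>rho_seminorm\<close>; but the term is 0, since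
    \<open>modulus f 0 = 0\<close> and \<infinity> * 0 = 0.\<close>
  proof (cases "t = 0")
    case True
    then show ?thesis using v_le by (simp add: weighted_modulus_def)
  next
    case False
    then have "weighted_modulus \<rho> f t \<le> rho_seminorm \<rho> f"
      unfolding rho_seminorm_def by (intro SUP_upper) (simp add: zero_less_iff_neq_zero)
    with v_le show ?thesis by (rule order_trans)
  qed
qed

text \<open>This is how one good pair of sites bounds the discrete seminorm from below: the pair
  itself competes in the discrete modulus at its own distance.\<close>

lemma quotient_le_discrete_seminorm:
  assumes "i \<in> {1..N}" "j \<in> {1..N}" "i \<noteq> j"
  shows "inverse (\<rho> (ennreal (dist (x i) (x j)))) * ennreal (dist (f (x i)) (f (x j))) \<le>
    discrete_seminorm \<rho> f x N"
proof -
  have "inverse (\<rho> (ennreal (dist (x i) (x j)))) * ennreal (dist (f (x i)) (f (x j))) \<le>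
      inverse (\<rho> (ennreal (dist (x i) (x j)))) *
      discrete_modulus f x N (ennreal (dist (x i) (x j)))"
    using assms by (intro mult_left_mono dist_le_discrete_modulus) auto
  also have "\<dots> \<le> discrete_seminorm \<rho> f x N"
    unfolding discrete_seminorm_def by (rule Max_ge[OF finite_pairs]) (use assms in blast)
  finally show ?thesis .
qed

lemma discrete_modulus_cong:
  assumes "\<And>i. i \<in> {1..N} \<Longrightarrow> f (x i) = g (x i)"
  shows "discrete_modulus f x N t = discrete_modulus g x N t"
  unfolding discrete_modulus_def
  by (rule arg_cong[where f = Max], rule Collect_cong) (metis assms)

text \<open>This identifies the seminorm of the restriction to the sites with that of the whole
  function.\<close>

lemma discrete_seminorm_cong:
  assumes "\<And>i. i \<in> {1..N} \<Longrightarrow> f (x i) = g (x i)"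
  shows "discrete_seminorm \<rho> f x N = discrete_seminorm \<rho> g x N"
proof -
  have "discrete_modulus f x N = discrete_modulus g x N"
    using assms by (intro ext discrete_modulus_cong)
  then show ?thesis by (simp add: discrete_seminorm_def)
qed

section \<open>Continuity of \<open>f\<close> from continuity of the weighted modulus\<close>

text \<open>For \<open>r = 0\<close> the factor \<open>inverse r\<close> is \<infinity>, so
  finiteness of the product forces \<open>m = 0\<close> and both sides vanish.\<close>

lemma ennreal_inverse_mult_cancel:
  fixes r m :: ennreal
  assumes "inverse r * m < \<infinity>" "r < \<infinity>"
  shows "(inverse r * m) * r = m"
proof (cases "r = 0")
  case True
  with assms have "m = 0" by (auto simp: ennreal_top_mult split: if_splits)
  then show ?thesis by simp
next
  case False
  have "(inverse r * m) * r = m * (r * inverse r)" by (simp add: ac_simps)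
  also have "r * inverse r = 1"
    using False assms by (simp add: ennreal_divide_self flip: divide_ennreal_def)
  finally show ?thesis by simp
qed

lemma ennreal_inverse_antimono: "a \<le> b \<Longrightarrow> inverse b \<le> inverse a" for a b :: ennreal
  by (simp add: less_eq_ennreal.rep_eq inverse_ennreal.rep_eq ereal_inverse_antimono)

text \<open>Near 0 the modulus is the product of the weighted modulus, which tends to the finite
  value \<open>c\<close>, and \<rho>. For the literal value at 0, \<open>c = 0\<close> while \<rho>
  stays below \<open>\<rho> t\<^sub>1\<close>; for the continuous extension, \<rho> itself tends to
  0. Either way the modulus tends to 0 at 0, which is uniform continuity. A point
  \<open>t\<^sub>1\<close> with finite \<rho> is required because the weighted modulus is 0 wherever
  \<rho> is \<infinity>, whatever \<open>f\<close> is.\<close>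

lemma continuous_if_continuous_weighted_modulus:
  fixes f :: "'a::metric_space \<Rightarrow> 'b::metric_space"
  assumes "mono \<rho>" "continuous_weighted_modulus \<rho> f" "t\<^sub>1 > 0" "\<rho> t\<^sub>1 < \<infinity>"
  shows "continuous_on UNIV f"
proof -
  let ?g = "weighted_modulus \<rho> f"
  from assms(2) obtain c where
    c: "c = ?g 0 \<or> \<rho> 0 = 0 \<and> isCont \<rho> 0" and
    cont: "continuous_on UNIV (?g(0 := c))" and
    fin: "\<And>t. (?g(0 := c)) t < \<infinity>"
    unfolding continuous_weighted_modulus_def by blast
  have g_fin: "?g t < \<infinity>" if "t > 0" for t
    using fin[of t] that by (auto split: if_splits)
  have c_fin: "c < \<infinity>"
    using fin[of 0] by simp
  have "isCont (?g(0 := c)) 0"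
    using cont by (simp add: continuous_on_eq_continuous_at del: fun_upd_apply)
  then have "((?g(0 := c)) \<longlongrightarrow> c) (at_right 0)"
    by (metis continuous_at_imp_continuous_within continuous_within fun_upd_same)
  then have g_lim: "(?g \<longlongrightarrow> c) (at_right 0)"
    by (rule Lim_transform_eventually) (auto simp: eventually_at_filter)
  have ev: "eventually (\<lambda>t. 0 < t \<and> t < t\<^sub>1) (at_right (0::ennreal))"
    using eventually_at_right_less[of 0] eventually_at_right[OF assms(3)] assms(3)
    by (auto simp: eventually_conj_iff)
  have mod_eq: "?g t * \<rho> t = modulus f t" if "0 < t" "t < t\<^sub>1" for t
  proof -
    have "\<rho> t \<le> \<rho> t\<^sub>1" using assms(1) that by (simp add: monoD)
    then have "\<rho> t < \<infinity>" using assms(4) by (rule le_less_trans)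
    then show ?thesis
      using g_fin[OF that(1)] ennreal_inverse_mult_cancel by (simp add: weighted_modulus_def)
  qed
  have "(modulus f \<longlongrightarrow> 0) (at_right 0)"
    using c
  proof
    assume "c = ?g 0"
    then have "c = 0" by (simp add: weighted_modulus_def)
    have "((\<lambda>t. ?g t * \<rho> t\<^sub>1) \<longlongrightarrow> c * \<rho> t\<^sub>1) (at_right 0)"
      using g_lim assms(4) c_fin by (intro tendsto_mult_ennreal tendsto_const) auto
    then have lim: "((\<lambda>t. ?g t * \<rho> t\<^sub>1) \<longlongrightarrow> 0) (at_right 0)"
      using \<open>c = 0\<close> by simp
    show ?thesis
    proof (rule tendsto_sandwich[OF _ _ tendsto_const lim])
      show "\<forall>\<^sub>F t in at_right 0. modulus f t \<le> ?g t * \<rho> t\<^sub>1"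
        using ev
      proof eventually_elim
        case (elim t)
        then have "?g t * \<rho> t \<le> ?g t * \<rho> t\<^sub>1"
          using assms(1) by (intro mult_left_mono) (auto simp: monoD)
        then show ?case using elim mod_eq by simp
      qed
    qed simp
  next
    assume \<rho>: "\<rho> 0 = 0 \<and> isCont \<rho> 0"
    then have "(\<rho> \<longlongrightarrow> 0) (at_right 0)"
      by (metis continuous_at_imp_continuous_within continuous_within)
    with g_lim have "((\<lambda>t. ?g t * \<rho> t) \<longlongrightarrow> c * 0) (at_right 0)"
      using c_fin by (intro tendsto_mult_ennreal) auto
    then have "((\<lambda>t. ?g t * \<rho> t) \<longlongrightarrow> 0) (at_right 0)" by simp
    then show ?thesis
      by (rule Lim_transform_eventually) (use ev in eventually_elim, simp add: mod_eq)
  qed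
  show ?thesis
    unfolding continuous_on_iff
  proof (intro ballI allI impI)
    fix y :: 'a and e :: real
    assume "e > 0"
    then have "\<forall>\<^sub>F t in at_right 0. modulus f t < ennreal e"
      by (intro order_tendstoD[OF \<open>(modulus f \<longlongrightarrow> 0) (at_right 0)\<close>]) simp
    with ev have "\<forall>\<^sub>F t in at_right 0. 0 < t \<and> t < t\<^sub>1 \<and> modulus f t < ennreal e"
      by eventually_elim simp
    then obtain b where "b > 0" "\<And>t. 0 < t \<Longrightarrow> t < b \<Longrightarrow> t < t\<^sub>1 \<and> modulus f t < ennreal e"
      using eventually_at_right[OF assms(3)] by auto
    then obtain t where t: "0 < t" "t < t\<^sub>1" "modulus f t < ennreal e"
      using dense[of 0 b] by blast
    then obtain d where d: "t = ennreal d" "d > 0"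
      by (cases t) auto
    have "dist (f z) (f y) < e" if "dist z y < d" for z
    proof -
      have "ennreal (dist (f z) (f y)) \<le> modulus f t"
        using that d by (intro dist_le_modulus) (simp add: ennreal_leI)
      also note t(3)
      finally show ?thesis by (simp add: ennreal_less_iff)
    qed
    then show "\<exists>d>0. \<forall>z\<in>UNIV. dist z y < d \<longrightarrow> dist (f z) (f y) < e"
      using d by blast
  qed
qed

section \<open>Compactness: extremal pairs and semicontinuity of the modulus\<close>

text \<open>The pairs at distance at most \<open>t\<close> form a compact set, nonempty because of
  the diagonal, on which the distance of the images has a maximum. The maximizing pair may lie at a
  distance below \<open>t\<close>.\<close>

lemma modulus_attained:
  fixes f :: "'a::metric_space \<Rightarrow> 'b::metric_space"
  assumes "compact (UNIV :: 'a set)" "continuous_on UNIV f"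
  obtains y y' where "ennreal (dist y y') \<le> t" "modulus f t = ennreal (dist (f y) (f y'))"
proof -
  let ?K = "{p :: 'a \<times> 'a. ennreal (dist (fst p) (snd p)) \<le> t}"
  have "closed ?K"
    by (intro closed_Collect_le continuous_intros continuous_on_ennreal)
  moreover have "compact (UNIV :: ('a \<times> 'a) set)"
    using compact_Times[OF assms(1) assms(1)] by simp
  ultimately have "compact ?K"
    using closed_Int_compact[of ?K UNIV] by simp
  moreover have "(undefined, undefined) \<in> ?K" by simp
  moreover have "continuous_on ?K (\<lambda>p. dist (f (fst p)) (f (snd p)))"
    by (intro continuous_intros continuous_on_compose2[OF assms(2)]) auto
  ultimately obtain p where p: "p \<in> ?K"
    "\<And>q. q \<in> ?K \<Longrightarrow> dist (f (fst q)) (f (snd q)) \<le> dist (f (fst p)) (f (snd p))"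
    using continuous_attains_sup[of ?K "\<lambda>p. dist (f (fst p)) (f (snd p))"] by blast
  have "modulus f t \<le> ennreal (dist (f (fst p)) (f (snd p)))"
    unfolding modulus_le_iff using p(2)[of "(_, _)"] by (auto intro!: ennreal_leI)
  moreover have "ennreal (dist (f (fst p)) (f (snd p))) \<le> modulus f t"
    using p(1) by (intro dist_le_modulus) simp
  ultimately show thesis
    using p(1) by (intro that[of "fst p" "snd p"]) auto
qed

text \<open>The pairs whose images are at least \<open>b\<close> apart form a compact set. Their
  least distance exceeds \<open>s\<close>, as the modulus at \<open>s\<close> is below
  \<open>b\<close>, and it serves as \<open>m\<close>: no such pair is closer than that.\<close>

lemma modulus_upper_semicontinuous:
  fixes f :: "'a::metric_space \<Rightarrow> 'b::metric_space"
  assumes "compact (UNIV :: 'a set)" "continuous_on UNIV f" "modulus f (ennreal s) < ennreal b"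
  obtains m where "m > s" "\<And>t. t < m \<Longrightarrow> modulus f (ennreal t) \<le> ennreal b"
proof -
  have b: "b > 0"
    using assms(3) by (metis ennreal_neg not_le not_less_zero)
  let ?K = "{p :: 'a \<times> 'a. b \<le> dist (f (fst p)) (f (snd p))}"
  have "closed ?K"
    by (intro closed_Collect_le continuous_intros continuous_on_compose2[OF assms(2)]) auto
  moreover have "compact (UNIV :: ('a \<times> 'a) set)"
    using compact_Times[OF assms(1) assms(1)] by simp
  ultimately have K: "compact ?K"
    using closed_Int_compact[of ?K UNIV] by simp
  \<comment> \<open>\<open>ennreal\<close> sends negative reals to 0, so \<open>m > 0\<close> is
    needed to get \<open>ennreal t < ennreal m\<close> from \<open>t < m\<close>.\<close>
  have main: "modulus f (ennreal t) \<le> ennreal b"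
    if m: "\<And>p. p \<in> ?K \<Longrightarrow> m \<le> dist (fst p) (snd p)" and "m > 0" "t < m" for m t
    unfolding modulus_le_iff
  proof (intro allI impI)
    fix y y' :: 'a
    assume le: "ennreal (dist y y') \<le> ennreal t"
    have "dist y y' < m"
      using le_less_trans[OF le, of "ennreal m"] that(2,3)
      by (metis ennreal_less_iff ennreal_lessI zero_le_dist)
    then have "(y, y') \<notin> ?K"
      using m[of "(y, y')"] by auto
    then show "ennreal (dist (f y) (f y')) \<le> ennreal b"
      by (auto intro: ennreal_leI)
  qed
  show thesis
  proof (cases "?K = {}")
    case True
    \<comment> \<open>Without such pairs any positive number above \<open>s\<close> will do.\<close>
    show ?thesis
      using True by (intro that[of "max 1 (s + 1)"] main[of "max 1 (s + 1)"]) auto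
  next
    case False
    have "continuous_on ?K (\<lambda>p. dist (fst p) (snd p))"
      by (intro continuous_intros)
    then obtain p where p: "p \<in> ?K"
      "\<And>q. q \<in> ?K \<Longrightarrow> dist (fst p) (snd p) \<le> dist (fst q) (snd q)"
      using continuous_attains_inf[OF K False] by blast
    have "dist (fst p) (snd p) > s"
    proof (rule ccontr)
      assume "\<not> ?thesis"
      then have "ennreal (dist (f (fst p)) (f (snd p))) \<le> modulus f (ennreal s)"
        by (intro dist_le_modulus ennreal_leI) simp
      also note assms(3)
      finally show False using p(1) by (simp add: ennreal_less_iff)
    qed
    moreover have "dist (fst p) (snd p) > 0"
      using p(1) b by auto
    ultimately show ?thesis
      using p(2) by (intro that[of "dist (fst p) (snd p)"] main) auto
  qed
qed

lemma dist_image_tendsto: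
  fixes f :: "'a::metric_space \<Rightarrow> 'b::metric_space"
  assumes "continuous_on UNIV f"
  shows "((\<lambda>p. ennreal (dist (f (fst p)) (f (snd p)))) \<longlongrightarrow>
    ennreal (dist (f y) (f y'))) (nhds (y, y'))"
proof -
  let ?D = "\<lambda>p. ennreal (dist (f (fst p)) (f (snd p)))"
  have "continuous_on UNIV ?D"
    by (intro continuous_on_ennreal continuous_intros continuous_on_compose2[OF assms]) auto
  then have "isCont ?D (y, y')"
    by (simp add: continuous_on_eq_continuous_at del: split_paired_All)
  then show ?thesis
    unfolding isCont_def using tendsto_at_iff_tendsto_nhds[of ?D "(y, y')"] by simp
qed

text \<open>As a function of \<open>t\<close> the modulus may jump from the left, for instance on a
  finite space. Along pairs near an extremal pair it cannot: it is at least the distance of their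
  images, which is continuous and equals the modulus at the extremal pair. The bound from above is
  upper semicontinuity.\<close>

lemma modulus_dist_tendsto:
  fixes f :: "'a::metric_space \<Rightarrow> 'b::metric_space"
  assumes "compact (UNIV :: 'a set)" "continuous_on UNIV f"
    and att: "modulus f (ennreal (dist y y')) = ennreal (dist (f y) (f y'))"
  shows "((\<lambda>p. modulus f (ennreal (dist (fst p) (snd p)))) \<longlongrightarrow>
    modulus f (ennreal (dist y y'))) (nhds (y, y'))"
proof -
  have d_lim: "((\<lambda>p. dist (fst p) (snd p)) \<longlongrightarrow> dist y y') (nhds (y, y'))"
    using tendsto_dist[OF tendsto_fst tendsto_snd, OF filterlim_ident filterlim_ident, of "(y, y')"]
    by simp
  have D_lim: "((\<lambda>p. ennreal (dist (f (fst p)) (f (snd p)))) \<longlongrightarrow>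
      ennreal (dist (f y) (f y'))) (nhds (y, y'))"
    using dist_image_tendsto[OF assms(2)] .
  show ?thesis
  proof (rule order_tendstoI)
    fix a
    assume "a < modulus f (ennreal (dist y y'))"
    then have "\<forall>\<^sub>F p in nhds (y, y'). a < ennreal (dist (f (fst p)) (f (snd p)))"
      using order_tendstoD(1)[OF D_lim] att by simp
    then show "\<forall>\<^sub>F p in nhds (y, y'). a < modulus f (ennreal (dist (fst p) (snd p)))"
      by eventually_elim (blast intro: less_le_trans dist_le_modulus)
  next
    fix a
    assume "modulus f (ennreal (dist y y')) < a"
    \<comment> \<open>An intermediate value is finite even if \<open>a\<close> is \<infinity>, and
      it turns the weak bound of the semicontinuity lemma into a strict one.\<close>
    then obtain b' where b': "modulus f (ennreal (dist y y')) < b'" "b' < a"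
      using dense by blast
    then obtain b where b: "b' = ennreal b"
      by (cases b') auto
    obtain m where m: "m > dist y y'" "\<And>t. t < m \<Longrightarrow> modulus f (ennreal t) \<le> ennreal b"
      using modulus_upper_semicontinuous[OF assms(1,2)] b' b by blast
    have "\<forall>\<^sub>F p in nhds (y, y'). dist (fst p) (snd p) < m"
      using order_tendstoD(2)[OF d_lim m(1)] .
    then show "\<forall>\<^sub>F p in nhds (y, y'). modulus f (ennreal (dist (fst p) (snd p))) < a"
      by eventually_elim (use m(2) b b'(2) in \<open>blast intro: le_less_trans\<close>)
  qed
qed

section \<open>Open sets of pairs with a large difference quotient\<close>

text \<open>With D the distance of the images and W the modulus at the distance of the pair,
  D/\<rho> = (W/\<rho>) * (D/W). The first factor is continuous by hypothesis and D/W tends to 1 at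
  an extremal pair, so continuity of \<rho> away from 0 never enters.\<close>

lemma open_pairs_with_large_quotient:
  fixes f :: "'a::metric_space \<Rightarrow> 'b::metric_space"
  assumes "compact (UNIV :: 'a set)" "mono \<rho>" "continuous_weighted_modulus \<rho> f"
    and "a < rho_seminorm \<rho> f"
  obtains U V where "open U" "open V" "U \<noteq> {}" "V \<noteq> {}" "U \<inter> V = {}"
    "\<And>z z'. z \<in> U \<Longrightarrow> z' \<in> V \<Longrightarrow>
      a < inverse (\<rho> (ennreal (dist z z'))) * ennreal (dist (f z) (f z'))"
proof -
  let ?g = "weighted_modulus \<rho> f"
  obtain t where t: "t > 0" "a < ?g t"
    using assms(4) unfolding rho_seminorm_def by (auto simp: less_SUP_iff)
  \<comment> \<open>If \<rho> were \<infinity> at \<open>t\<close>, then \<open>?g t\<close> would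
    be 0, not above \<open>a\<close>.\<close>
  have \<rho>_fin: "\<rho> t < \<infinity>"
    using t(2) by (auto simp: weighted_modulus_def less_top[symmetric])
  have cont_f: "continuous_on UNIV f"
    using continuous_if_continuous_weighted_modulus[OF assms(2,3) t(1) \<rho>_fin] .
  obtain y y' where y: "ennreal (dist y y') \<le> t" "modulus f t = ennreal (dist (f y) (f y'))"
    using modulus_attained[OF assms(1) cont_f] .
  let ?s = "ennreal (dist y y')"
  have mod_s: "modulus f ?s = ennreal (dist (f y) (f y'))"
    using y(2) modulus_mono[OF y(1), of f] dist_le_modulus[of y y' ?s f] by simp
  \<comment> \<open>The modulus is the same at both points, and \<rho> is no larger at
    \<open>?s\<close>.\<close>
  have "?g t \<le> ?g ?s"
    unfolding weighted_modulus_def mod_s y(2)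
    using assms(2) y(1) by (intro mult_right_mono) (auto simp: monoD ennreal_inverse_antimono)
  with t(2) have a: "a < ?g ?s" by (rule less_le_trans)
  then have ne: "f y \<noteq> f y'"
    by (auto simp: weighted_modulus_def mod_s)
  then have "y \<noteq> y'" by auto
  have D_pos: "ennreal (dist (f y) (f y')) \<noteq> 0"
    using ne by simp
  from assms(3) obtain c where cont: "continuous_on UNIV (?g(0 := c))"
    unfolding continuous_weighted_modulus_def by blast
  have s_pos: "?s \<noteq> 0" using \<open>y \<noteq> y'\<close> by simp
  have d_lim: "((\<lambda>p. ennreal (dist (fst p) (snd p))) \<longlongrightarrow> ?s) (nhds (y, y'))"
    using tendsto_dist[OF tendsto_fst tendsto_snd, OF filterlim_ident filterlim_ident,
        of "(y, y')"]
    by (intro tendsto_ennrealI) simp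
  have "isCont (?g(0 := c)) ?s"
    using cont by (simp add: continuous_on_eq_continuous_at del: fun_upd_apply)
  then have "((\<lambda>p. (?g(0 := c)) (ennreal (dist (fst p) (snd p)))) \<longlongrightarrow> (?g(0 := c)) ?s)
      (nhds (y, y'))"
    using d_lim by (rule isCont_tendsto_compose)
  then have "((\<lambda>p. (?g(0 := c)) (ennreal (dist (fst p) (snd p)))) \<longlongrightarrow> ?g ?s) (nhds (y, y'))"
    using s_pos by simp
  \<comment> \<open>Pairs close to the extremal one stay off the diagonal, so the modified value
    \<open>c\<close> at 0 is never met.\<close>
  moreover have pos: "\<forall>\<^sub>F p in nhds (y, y'). ennreal (dist (fst p) (snd p)) > 0"
    using s_pos by (intro order_tendstoD(1)[OF d_lim]) (simp add: zero_less_iff_neq_zero)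
  then have "\<forall>\<^sub>F p in nhds (y, y'). (?g(0 := c)) (ennreal (dist (fst p) (snd p))) =
      ?g (ennreal (dist (fst p) (snd p)))"
    by eventually_elim auto
  ultimately have G_lim: "((\<lambda>p. ?g (ennreal (dist (fst p) (snd p)))) \<longlongrightarrow> ?g ?s) (nhds (y, y'))"
    by (rule Lim_transform_eventually)
  let ?D = "\<lambda>p. ennreal (dist (f (fst p)) (f (snd p)))"
  let ?W = "\<lambda>p. modulus f (ennreal (dist (fst p) (snd p)))"
  have D_lim: "(?D \<longlongrightarrow> ennreal (dist (f y) (f y'))) (nhds (y, y'))"
    using dist_image_tendsto[OF cont_f] .
  have W_lim: "(?W \<longlongrightarrow> ennreal (dist (f y) (f y'))) (nhds (y, y'))"
    using modulus_dist_tendsto[OF assms(1) cont_f mod_s] mod_s by simp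
  have inv_lim: "((\<lambda>p. inverse (?W p)) \<longlongrightarrow> inverse (ennreal (dist (f y) (f y')))) (nhds (y, y'))"
    using continuous_on_inverse_ennreal[OF continuous_on_id[of UNIV]] W_lim
    by (rule continuous_on_tendsto_compose) auto
  have "((\<lambda>p. ?D p * inverse (?W p)) \<longlongrightarrow>
      ennreal (dist (f y) (f y')) * inverse (ennreal (dist (f y) (f y')))) (nhds (y, y'))"
    using D_lim inv_lim D_pos by (intro tendsto_mult_ennreal) auto
  also have "ennreal (dist (f y) (f y')) * inverse (ennreal (dist (f y) (f y'))) = 1"
    using D_pos by (simp add: ennreal_divide_self flip: divide_ennreal_def)
  finally have ratio_lim: "((\<lambda>p. ?D p * inverse (?W p)) \<longlongrightarrow> 1) (nhds (y, y'))" .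
  have "((\<lambda>p. ?g (ennreal (dist (fst p) (snd p))) * (?D p * inverse (?W p))) \<longlongrightarrow> ?g ?s * 1)
      (nhds (y, y'))"
    by (rule tendsto_mult_ennreal[OF G_lim ratio_lim]) auto
  then have "\<forall>\<^sub>F p in nhds (y, y'). a < ?g (ennreal (dist (fst p) (snd p))) * (?D p * inverse (?W p))"
    using a by (intro order_tendstoD(1)) auto
  \<comment> \<open>The limit of \<open>?W\<close> is positive and finite; this is what allows
    cancelling it below.\<close>
  moreover have "\<forall>\<^sub>F p in nhds (y, y'). 0 < ?W p \<and> ?W p < \<infinity>"
    using D_pos
    by (intro eventually_conj order_tendstoD[OF W_lim]) (auto simp: zero_less_iff_neq_zero)
  ultimately have "\<forall>\<^sub>F p in nhds (y, y').
      a < inverse (\<rho> (ennreal (dist (fst p) (snd p)))) * ?D p"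
  proof eventually_elim
    case (elim p)
    have "?g (ennreal (dist (fst p) (snd p))) * (?D p * inverse (?W p)) =
        inverse (\<rho> (ennreal (dist (fst p) (snd p)))) * ?D p * (?W p * inverse (?W p))"
      by (simp add: weighted_modulus_def ac_simps)
    also have "?W p * inverse (?W p) = 1"
      using elim by (simp add: ennreal_divide_self zero_less_iff_neq_zero flip: divide_ennreal_def)
    finally show ?case using elim by simp
  qed
  then obtain S where S: "open S" "(y, y') \<in> S"
    "\<And>p. p \<in> S \<Longrightarrow> a < inverse (\<rho> (ennreal (dist (fst p) (snd p)))) * ?D p"
    unfolding eventually_nhds by blast
  obtain A B where AB: "open A" "open B" "y \<in> A" "y' \<in> B" "A \<times> B \<subseteq> S"
    using open_prod_elim[OF S(1,2)] by (metis mem_Sigma_iff)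
  \<comment> \<open>Disjointness will ensure that sites found in the two sets have different
    indices.\<close>
  obtain A' B' where AB': "open A'" "open B'" "y \<in> A'" "y' \<in> B'" "A' \<inter> B' = {}"
    using hausdorff[OF \<open>y \<noteq> y'\<close>] by blast
  show thesis
  proof (rule that[of "A \<inter> A'" "B \<inter> B'"])
    fix z z'
    assume "z \<in> A \<inter> A'" "z' \<in> B \<inter> B'"
    then have "(z, z') \<in> S" using AB by blast
    then show "a < inverse (\<rho> (ennreal (dist z z'))) * ennreal (dist (f z) (f z'))"
      using S(3) by fastforce
  qed (use AB AB' in auto)
qed

section \<open>Almost sure density of the sample\<close>

text \<open>By independence the first n + 1 sites all miss \<open>U\<close> with probability (1 -
  P(U))^(n + 1), which tends to 0.\<close>

lemma (in prob_space) AE_sample_hits: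
  assumes indep: "indep_vars (\<lambda>_. N) x {1..}"
    and distr: "\<And>i. i \<ge> (1::nat) \<Longrightarrow> distr M N (x i) = P"
    and U: "U \<in> sets N" "emeasure P U > 0"
  shows "AE w in M. \<exists>i\<ge>1. x i w \<in> U"
proof -
  have meas: "x i \<in> measurable M N" if "i \<ge> 1" for i
    using indep that by (auto simp: indep_vars_def)
  \<comment> \<open>\<open>Suc n\<close> keeps the index set nonempty, as the product formula for
    independent variables requires.\<close>
  let ?E = "\<lambda>n. \<Inter>i\<in>{1..Suc n}. x i -` (space N - U) \<inter> space M"
  have q: "prob (x i -` (space N - U) \<inter> space M) = 1 - measure P U" if "i \<ge> 1" for i
  proof -
    have sp: "space N - U \<in> sets N" using U by auto
    interpret D: prob_space P
      using prob_space_distr[OF meas[OF that]] distr[OF that] by simp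
    have sets_P: "sets P = sets N"
      using distr[OF that] by (metis sets_distr)
    have "prob (x i -` (space N - U) \<inter> space M) = measure P (space N - U)"
      using measure_distr[OF meas[OF that] sp] distr[OF that] by simp
    also have "\<dots> = 1 - measure P U"
      using D.prob_compl[of U] U(1) sets_P sets_eq_imp_space_eq[OF sets_P] by simp
    finally show ?thesis .
  qed
  interpret D: prob_space P
    using prob_space_distr[OF meas[of 1]] distr[of 1] by simp
  have pos: "measure P U > 0"
    using U(2) by (simp add: D.emeasure_eq_measure)
  have E: "prob (?E n) = (1 - measure P U) ^ Suc n" for n
  proof -
    have "prob (?E n) = (\<Prod>i\<in>{1..Suc n}. prob (x i -` (space N - U) \<inter> space M))"
      using U by (intro indep_varsD[OF indep]) auto
    also have "\<dots> = (\<Prod>i\<in>{1..Suc n}. 1 - measure P U)"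
      by (intro prod.cong refl q) auto
    finally show ?thesis by simp
  qed
  have E_ev: "?E n \<in> events" for n
    using U(1) by (intro sets.finite_INT) (auto intro!: measurable_sets[OF meas])
  have lim: "(\<lambda>n. (1 - measure P U) ^ Suc n) \<longlonglongrightarrow> 0"
    using pos by (intro LIMSEQ_Suc LIMSEQ_realpow_zero) auto
  have I_ev: "(\<Inter>n. ?E n) \<in> events"
    using E_ev by (intro sets.countable_INT) auto
  have "prob (\<Inter>n. ?E n) \<le> (1 - measure P U) ^ Suc n" for n
    unfolding E[symmetric] by (intro finite_measure_mono E_ev) blast
  then have "prob (\<Inter>n. ?E n) \<le> 0"
    by (intro LIMSEQ_le_const[OF lim]) auto
  then have "emeasure M (\<Inter>n. ?E n) = 0"
    by (simp add: emeasure_eq_measure measure_le_0_iff)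
  then show ?thesis
  proof (rule AE_I'[OF null_setsI[OF _ I_ev]], intro subsetI)
    fix w assume "w \<in> {w \<in> space M. \<not> (\<exists>i\<ge>1. x i w \<in> U)}"
    then show "w \<in> (\<Inter>n. ?E n)"
      using measurable_space[OF meas] by fastforce
  qed
qed

text \<open>The null set must not depend on the open set. Finite covers by balls of radius 1/(n +
  1), one for each n, give countably many balls, each hit almost surely; every nonempty open set
  contains one of them.\<close>

lemma (in prob_space) AE_sample_dense:
  fixes x :: "nat \<Rightarrow> 'a \<Rightarrow> 'b::metric_space"
  assumes "compact (UNIV :: 'b set)" "nondegenerate P"
    and indep: "indep_vars (\<lambda>_. borel) x {1..}"
    and distr: "\<And>i. i \<ge> (1::nat) \<Longrightarrow> distr M borel (x i) = P"
  shows "AE w in M. \<forall>U. open U \<longrightarrow> U \<noteq> {} \<longrightarrow> (\<exists>i\<ge>1. x i w \<in> U)"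
proof -
  have "\<exists>C. finite C \<and> (UNIV :: 'b set) \<subseteq> (\<Union>c\<in>C. ball c (inverse (real (Suc n))))" for n
    using assms(1) unfolding compact_eq_totally_bounded by auto
  then obtain C where C: "\<And>n. finite (C n)"
    "\<And>n. (UNIV :: 'b set) \<subseteq> (\<Union>c\<in>C n. ball c (inverse (real (Suc n))))"
    by metis
  have "AE w in M. \<exists>i\<ge>1. x i w \<in> ball c (inverse (real (Suc n)))" for c n
  proof (rule AE_sample_hits[OF indep distr])
    show "emeasure P (ball c (inverse (real (Suc n)))) > 0"
      using assms(2) unfolding nondegenerate_def
      by (metis open_ball centre_in_ball inverse_positive_iff_positive of_nat_0_less_iff zero_less_Suc)
  qed auto
  then have "AE w in M. \<forall>n. \<forall>c\<in>C n. \<exists>i\<ge>1. x i w \<in> ball c (inverse (real (Suc n)))"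
    using C(1) by (simp add: AE_all_countable AE_finite_all)
  then show ?thesis
  proof eventually_elim
    case (elim w)
    show ?case
    proof (intro allI impI)
      fix U :: "'b set"
      assume "open U" "U \<noteq> {}"
      then obtain u e where u: "u \<in> U" "e > 0" "ball u e \<subseteq> U"
        by (metis all_not_in_conv openE)
      \<comment> \<open>The radius counts twice: from \<open>u\<close> to the centre
        \<open>c\<close>, and from \<open>c\<close> to the site.\<close>
      obtain n where n: "inverse (real (Suc n)) < e / 2"
        using reals_Archimedean[of "e / 2"] u(2) by auto
      obtain c where c: "c \<in> C n" "dist c u < inverse (real (Suc n))"
        using C(2)[of n] by (auto simp: subset_iff)
      obtain i where i: "i \<ge> 1" "dist c (x i w) < inverse (real (Suc n))"
        using elim c(1) by (metis mem_ball)
      have "dist u (x i w) < e"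
        using dist_triangle[of u "x i w" c] c(2) i(2) n by (simp add: dist_commute)
      then show "\<exists>i\<ge>1. x i w \<in> U"
        using i(1) u(3) by auto
    qed
  qed
qed

section \<open>Convergence of the discrete seminorm\<close>

text \<open>This is deterministic: chance enters only through density of the sites. From above, the
  discrete seminorm is bounded by the full one once \<open>N \<ge> 2\<close>; from below, two sites
  with quotient above \<open>a\<close> count as soon as both have been drawn.\<close>

lemma discrete_seminorm_tendsto:
  fixes f :: "'a::metric_space \<Rightarrow> 'b::metric_space"
  assumes "compact (UNIV :: 'a set)" "mono \<rho>" "continuous_weighted_modulus \<rho> f"
    and dense: "\<And>U. open U \<Longrightarrow> U \<noteq> {} \<Longrightarrow> \<exists>i\<ge>1. x i \<in> U"
  shows "(\<lambda>N. discrete_seminorm \<rho> f x N) \<longlonglongrightarrow> rho_seminorm \<rho> f"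
proof (rule order_tendstoI)
  fix a
  assume "a < rho_seminorm \<rho> f"
  then obtain U V where UV: "open U" "open V" "U \<noteq> {}" "V \<noteq> {}" "U \<inter> V = {}"
    "\<And>z z'. z \<in> U \<Longrightarrow> z' \<in> V \<Longrightarrow>
      a < inverse (\<rho> (ennreal (dist z z'))) * ennreal (dist (f z) (f z'))"
    using open_pairs_with_large_quotient[OF assms(1-3)] by metis
  obtain i j where ij: "i \<ge> 1" "x i \<in> U" "j \<ge> 1" "x j \<in> V"
    using dense UV by meson
  then have "i \<noteq> j" using UV(5) by auto
  show "\<forall>\<^sub>F N in sequentially. a < discrete_seminorm \<rho> f x N"
    using eventually_ge_at_top[of "max i j"]
  proof eventually_elim
    case (elim N)
    have "a < inverse (\<rho> (ennreal (dist (x i) (x j)))) * ennreal (dist (f (x i)) (f (x j)))"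
      using UV(6) ij by blast
    also have "\<dots> \<le> discrete_seminorm \<rho> f x N"
      using ij \<open>i \<noteq> j\<close> elim by (intro quotient_le_discrete_seminorm) auto
    finally show ?case .
  qed
next
  fix a
  assume "rho_seminorm \<rho> f < a"
  show "\<forall>\<^sub>F N in sequentially. discrete_seminorm \<rho> f x N < a"
    using eventually_ge_at_top[of 2]
    by eventually_elim
      (metis discrete_seminorm_le_rho_seminorm le_less_trans \<open>rho_seminorm \<rho> f < a\<close>)
qed

theorem theorem4p11:
  fixes P :: "'a::metric_space measure"
    and f :: "'a \<Rightarrow> 'b::metric_space"
    and \<rho> :: "ennreal \<Rightarrow> ennreal"
    and \<Omega> :: "'w measure"
    and x :: "nat \<Rightarrow> 'w \<Rightarrow> 'a"
  assumes "compact (UNIV :: 'a set)"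
    and "prob_space P"
    and "sets P = sets borel"
    and "nondegenerate P"
    and "prob_space \<Omega>"
    and "prob_space.indep_vars \<Omega> (\<lambda>_. borel) x {1..}"
    and "\<And>i. i \<ge> 1 \<Longrightarrow> distr \<Omega> borel (x i) = P"
    and "mono \<rho>"
    and "continuous_weighted_modulus \<rho> f"
    and "rho_seminorm \<rho> f < \<infinity>"
  shows "AE w in \<Omega>.
    (\<lambda>N. discrete_seminorm \<rho> (restrict f ((\<lambda>i. x i w) ` {1..N})) (\<lambda>i. x i w) N)
        \<longlonglongrightarrow> rho_seminorm \<rho> f \<and>
    (\<lambda>N. discrete_seminorm \<rho> f (\<lambda>i. x i w) N) \<longlonglongrightarrow> rho_seminorm \<rho> f"
proof -
  have "AE w in \<Omega>. \<forall>U. open U \<longrightarrow> U \<noteq> {} \<longrightarrow> (\<exists>i\<ge>1. x i w \<in> U)"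
    by (rule prob_space.AE_sample_dense[OF assms(5,1,4,6,7)])
  then show ?thesis
  proof eventually_elim
    case (elim w)
    \<comment> \<open>Off the sites \<open>restrict\<close> returns \<open>undefined\<close>, a
      value that the discrete seminorm never sees.\<close>
    have "discrete_seminorm \<rho> (restrict f ((\<lambda>i. x i w) ` {1..N})) (\<lambda>i. x i w) N =
        discrete_seminorm \<rho> f (\<lambda>i. x i w) N" for N
      by (rule discrete_seminorm_cong) simp
    then show ?case
      using discrete_seminorm_tendsto[OF assms(1,8,9), of "\<lambda>i. x i w"] elim by simp
  qed
qed

end
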